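(* For every integer $n\geq 2$, the set $X^{\tau_\sigma}$ of valid tilings of $BS(1,n)$ by the tileset $\tau_\sigma$ is a subshift of finite type on $BS(1,n)$ that is weakly aperiodic but not strongly aperiodic.
   Context: $BS(1,n)=\langle a,b \mid b a b^{-1} = a^n\rangle$, with identity $e$. For $r\in\{0,\dots,n-1\}$, $\sigma_r$ is the substitution $\{0,1\}\to\{0,1\}^n$ given by $\sigma_r(0)=0^{n-r-1}10^r$ and $\sigma_r(1)=0^n$; the letters of the word $\sigma_r(c)$ are indexed $\sigma_r(c)_0,\dots,\sigma_r(c)_{n-1}$. A Wang tile of $BS(1,n)$ is a tuple of colors $s=(t,l,r,b_1,\dots,b_n)$, with $s(\text{top})=t$, $s(\text{left})=l$, $s(\text{right})=r$, $s(\text{bottom}_j)=b_j$. The tileset $\tau_\sigma$ consists of one tile for each pair $(c,i)\in\{0,1\}\times\{0,\dots,n-1\}$: its top color is $c$, its left and right colors are both $i$, and its bottom colors are $\text{bottom}_j=\sigma_i(c)_{j-1}$ for $1\leq j\leq n$. $X^{\tau_\sigma}$ is the set of all $T\in\tau_\sigma^{BS(1,n)}$ such that for all $g\in BS(1,n)$ and all $j\in\{1,\dots,n\}$: $T_g(\text{right})=T_{ga}(\text{left})$ and $T_g(\text{top})=T_{ga^{1-j}b}(\text{bottom}_j)$. A group $G$ acts on $\mathcal{A}^G$ ($\mathcal{A}$ a finite alphabet) by $(g\cdot x)_h=x_{g^{-1}h}$. A pattern is an element $p\in\mathcal{A}^P$ with $P\subset G$ finite; it appears in $x$ if there is $g\in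 G$ with $(g\cdot x)_h=p_h$ for all $h\in P$. A subshift of finite type (SFT) on $G$ is the set of all $x\in\mathcal{A}^G$ in which no pattern of some fixed finite set appears. A configuration $x$ is strongly periodic if its orbit $\{g\cdot x\mid g\in G\}$ is finite, and weakly periodic if its stabilizer is not $\{e\}$. An SFT is weakly (resp. strongly) aperiodic if it is non-empty and contains no strongly (resp. weakly) periodic configuration. *)

theory Defs
  imports "HOL-Algebra.Group_Action"
begin

section \<open>Groups given by generators and relations\<close>

text \<open>A letter \<open>(x, True)\<close> stands for the generator \<open>x\<close> and \<open>(x, False)\<close> for its formal
  inverse. A pair \<open>(u, v) \<in> R\<close> stands for the relation \<open>u = v\<close>.\<close>

type_synonym 'g word = "('g \<times> bool) list"

inductive pres_eq :: "('g word \<times> 'g word) set \<Rightarrow> 'g word \<Rightarrow> 'g word \<Rightarrow> bool"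
  for R where
  pres_refl: "pres_eq R u u"
| pres_sym: "pres_eq R u v \<Longrightarrow> pres_eq R v u"
| pres_trans: "pres_eq R u v \<Longrightarrow> pres_eq R v w \<Longrightarrow> pres_eq R u w"
| pres_append: "pres_eq R u u' \<Longrightarrow> pres_eq R v v' \<Longrightarrow> pres_eq R (u @ v) (u' @ v')"
| pres_cancel: "pres_eq R [(x, s), (x, \<not> s)] []"
| pres_relation: "(u, v) \<in> R \<Longrightarrow> pres_eq R u v"

definition pres_rel :: "('g word \<times> 'g word) set \<Rightarrow> ('g word \<times> 'g word) set" where
  "pres_rel R = {(u, v). pres_eq R u v}"

definition presented_group :: "('g word \<times> 'g word) set \<Rightarrow> 'g word set monoid" where
  "presented_group R =
    \<lparr>carrier = UNIV // pres_rel R,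
     mult = (\<lambda>X Y. \<Union>u\<in>X. \<Union>v\<in>Y. pres_rel R `` {u @ v}),
     one = pres_rel R `` {[]}\<rparr>"

lemma equiv_pres_rel: "equiv UNIV (pres_rel R)"
proof (rule equivI)
  show "refl (pres_rel R)" by (auto simp: refl_on_def pres_rel_def intro: pres_refl)
  show "sym (pres_rel R)" by (auto simp: sym_def pres_rel_def intro: pres_sym)
  show "trans (pres_rel R)" by (auto simp: trans_def pres_rel_def intro: pres_trans)
qed auto

lemma presented_group_mult:
  "pres_rel R `` {u} \<otimes>\<^bsub>presented_group R\<^esub> pres_rel R `` {v} = pres_rel R `` {u @ v}"
proof -
  have "congruent2 (pres_rel R) (pres_rel R) (\<lambda>u v. pres_rel R `` {u @ v})"
    by (rule congruent2I')
      (metis (no_types, lifting) equiv_class_eq equiv_pres_rel mem_Collect_eq old.prod.case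
        pres_append pres_rel_def)
  from UN_equiv_class2[OF equiv_pres_rel equiv_pres_rel this]
  show ?thesis by (simp add: presented_group_def)
qed

lemma pres_inverse_word: "pres_eq R (rev (map (\<lambda>(x, s). (x, \<not> s)) w) @ w) []"
proof (induction w)
  case Nil
  show ?case by (simp add: pres_refl)
next
  case (Cons l w)
  obtain x s where l: "l = (x, s)" by (cases l)
  let ?i = "rev (map (\<lambda>(x, s). (x, \<not> s)) w)"
  have "pres_eq R [(x, \<not> s), (x, s)] []"
    using pres_cancel[of R x "\<not> s"] by simp
  then have "pres_eq R (?i @ ([(x, \<not> s), (x, s)] @ w)) (?i @ ([] @ w))"
    by (intro pres_append pres_refl)
  then show ?case
    using Cons.IH l by (auto intro: pres_trans)
qed

lemma group_presented_group: "group (presented_group R)"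
proof (rule groupI)
  let ?G = "presented_group R"
  have cls: "\<exists>u. X = pres_rel R `` {u}" if "X \<in> carrier ?G" for X
    using that by (auto simp: presented_group_def elim: quotientE)
  have inc: "pres_rel R `` {u} \<in> carrier ?G" for u
    by (auto simp: presented_group_def intro: quotientI)
  have one: "\<one>\<^bsub>?G\<^esub> = pres_rel R `` {[]}"
    by (simp add: presented_group_def)
  show "X \<otimes>\<^bsub>?G\<^esub> Y \<in> carrier ?G" if "X \<in> carrier ?G" "Y \<in> carrier ?G" for X Y
    using cls[OF that(1)] cls[OF that(2)] inc by (auto simp: presented_group_mult)
  show "\<one>\<^bsub>?G\<^esub> \<in> carrier ?G"
    using inc one by simp
  show "X \<otimes>\<^bsub>?G\<^esub> Y \<otimes>\<^bsub>?G\<^esub> Z = X \<otimes>\<^bsub>?G\<^esub> (Y \<otimes>\<^bsub>?G\<^esub> Z)"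
    if "X \<in> carrier ?G" "Y \<in> carrier ?G" "Z \<in> carrier ?G" for X Y Z
    using cls[OF that(1)] cls[OF that(2)] cls[OF that(3)] by (auto simp: presented_group_mult)
  show "\<one>\<^bsub>?G\<^esub> \<otimes>\<^bsub>?G\<^esub> X = X" if "X \<in> carrier ?G" for X
    using cls[OF that] by (auto simp: one presented_group_mult)
  show "\<exists>Y\<in>carrier ?G. Y \<otimes>\<^bsub>?G\<^esub> X = \<one>\<^bsub>?G\<^esub>" if "X \<in> carrier ?G" for X
  proof -
    from cls[OF that] obtain u where u: "X = pres_rel R `` {u}" ..
    let ?Y = "pres_rel R `` {rev (map (\<lambda>(x, s). (x, \<not> s)) u)}"
    have "?Y \<otimes>\<^bsub>?G\<^esub> X = \<one>\<^bsub>?G\<^esub>"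
      unfolding u one presented_group_mult
      by (rule equiv_class_eq[OF equiv_pres_rel]) (simp add: pres_rel_def pres_inverse_word)
    with inc show ?thesis by blast
  qed
qed

section \<open>The Baumslag--Solitar group \<open>BS(1,n)\<close>\<close>

datatype bs_generator = GenA | GenB

definition BS_relations :: "nat \<Rightarrow> (bs_generator word \<times> bs_generator word) set" where
  "BS_relations n =
    {([(GenB, True), (GenA, True), (GenB, False)], replicate n (GenA, True))}"

definition BS :: "nat \<Rightarrow> bs_generator word set monoid" where
  "BS n = presented_group (BS_relations n)"

definition bs_a :: "nat \<Rightarrow> bs_generator word set" where
  "bs_a n = pres_rel (BS_relations n) `` {[(GenA, True)]}"

definition bs_b :: "nat \<Rightarrow> bs_generator word set" where
  "bs_b n = pres_rel (BS_relations n) `` {[(GenB, True)]}"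

lemma group_BS: "group (BS n)"
  by (simp add: BS_def group_presented_group)

lemma bs_a_carrier: "bs_a n \<in> carrier (BS n)"
  and bs_b_carrier: "bs_b n \<in> carrier (BS n)"
  by (auto simp: bs_a_def bs_b_def BS_def presented_group_def intro: quotientI)

lemma BS_relation:
  "bs_b n \<otimes>\<^bsub>BS n\<^esub> bs_a n \<otimes>\<^bsub>BS n\<^esub> inv\<^bsub>BS n\<^esub> bs_b n = bs_a n [^]\<^bsub>BS n\<^esub> n"
proof -
  let ?c = "\<lambda>w. pres_rel (BS_relations n) `` {w}"
  interpret G: group "BS n" by (rule group_BS)
  have mult: "?c u \<otimes>\<^bsub>BS n\<^esub> ?c v = ?c (u @ v)" for u v
    by (simp add: BS_def presented_group_mult)
  have one: "\<one>\<^bsub>BS n\<^esub> = ?c []"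
    by (simp add: BS_def presented_group_def)
  have binv: "inv\<^bsub>BS n\<^esub> bs_b n = ?c [(GenB, False)]"
  proof (rule G.inv_equality)
    have "pres_eq (BS_relations n) [(GenB, False), (GenB, True)] []"
      using pres_cancel[of "BS_relations n" GenB False] by simp
    then show "?c [(GenB, False)] \<otimes>\<^bsub>BS n\<^esub> bs_b n = \<one>\<^bsub>BS n\<^esub>"
      unfolding bs_b_def mult one
      by (intro equiv_class_eq[OF equiv_pres_rel]) (simp add: pres_rel_def)
  qed (auto simp: bs_b_def BS_def presented_group_def intro: quotientI)
  have pow: "bs_a n [^]\<^bsub>BS n\<^esub> k = ?c (replicate k (GenA, True))" for k :: nat
    by (induction k) (simp_all add: one mult bs_a_def replicate_append_same)
  have "?c [(GenB, True), (GenA, True), (GenB, False)] = ?c (replicate n (GenA, True))"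
    by (rule equiv_class_eq[OF equiv_pres_rel])
      (simp add: pres_rel_def pres_relation BS_relations_def)
  then show ?thesis
    unfolding binv pow by (simp add: bs_a_def bs_b_def mult)
qed

section \<open>Configurations, subshifts of finite type and periodicity\<close>

definition configurations :: "('a, 'm) monoid_scheme \<Rightarrow> 'c set \<Rightarrow> ('a \<Rightarrow> 'c) set" where
  "configurations G A = carrier G \<rightarrow>\<^sub>E A"

definition shift :: "('a, 'm) monoid_scheme \<Rightarrow> 'a \<Rightarrow> ('a \<Rightarrow> 'c) \<Rightarrow> 'a \<Rightarrow> 'c" where
  "shift G g x = (\<lambda>h\<in>carrier G. x (inv\<^bsub>G\<^esub> g \<otimes>\<^bsub>G\<^esub> h))"

definition patterns :: "('a, 'm) monoid_scheme \<Rightarrow> 'c set \<Rightarrow> ('a set \<times> ('a \<Rightarrow> 'c)) set" where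
  "patterns G A = {(P, p). P \<subseteq> carrier G \<and> finite P \<and> p \<in> P \<rightarrow>\<^sub>E A}"

definition appears_in ::
  "('a, 'm) monoid_scheme \<Rightarrow> 'a set \<times> ('a \<Rightarrow> 'c) \<Rightarrow> ('a \<Rightarrow> 'c) \<Rightarrow> bool" where
  "appears_in G q x \<longleftrightarrow> (\<exists>g\<in>carrier G. \<forall>h\<in>fst q. shift G g x h = snd q h)"

definition SFT :: "('a, 'm) monoid_scheme \<Rightarrow> 'c set \<Rightarrow> ('a \<Rightarrow> 'c) set \<Rightarrow> bool" where
  "SFT G A X \<longleftrightarrow> finite A \<and>
    (\<exists>F. finite F \<and> F \<subseteq> patterns G A \<and>
      X = {x \<in> configurations G A. \<forall>q\<in>F. \<not> appears_in G q x})"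

definition strongly_periodic :: "('a, 'm) monoid_scheme \<Rightarrow> ('a \<Rightarrow> 'c) \<Rightarrow> bool" where
  "strongly_periodic G x \<longleftrightarrow> finite (orbit G (shift G) x)"

definition weakly_periodic :: "('a, 'm) monoid_scheme \<Rightarrow> ('a \<Rightarrow> 'c) \<Rightarrow> bool" where
  "weakly_periodic G x \<longleftrightarrow> stabilizer G (shift G) x \<noteq> {\<one>\<^bsub>G\<^esub>}"

definition weakly_aperiodic :: "('a, 'm) monoid_scheme \<Rightarrow> ('a \<Rightarrow> 'c) set \<Rightarrow> bool" where
  "weakly_aperiodic G X \<longleftrightarrow> X \<noteq> {} \<and> (\<forall>x\<in>X. \<not> strongly_periodic G x)"

definition strongly_aperiodic :: "('a, 'm) monoid_scheme \<Rightarrow> ('a \<Rightarrow> 'c) set \<Rightarrow> bool" where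
  "strongly_aperiodic G X \<longleftrightarrow> X \<noteq> {} \<and> (\<forall>x\<in>X. \<not> weakly_periodic G x)"

section \<open>Wang tiles of \<open>BS(1,n)\<close> and the tileset of the substitutions\<close>

record wang_tile =
  top_color :: nat
  left_color :: nat
  right_color :: nat
  bottom_colors :: "nat list"

text \<open>The bottom colors of a tile are numbered from 1, the entries of a list from 0.\<close>

definition bottom :: "wang_tile \<Rightarrow> nat \<Rightarrow> nat" where
  "bottom s j = bottom_colors s ! (j - 1)"

definition wang_tiles :: "nat \<Rightarrow> wang_tile set" where
  "wang_tiles n = {s. length (bottom_colors s) = n}"

definition valid_tilings ::
  "nat \<Rightarrow> wang_tile set \<Rightarrow> (bs_generator word set \<Rightarrow> wang_tile) set" where
  "valid_tilings n \<tau> =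
    {T \<in> configurations (BS n) \<tau>. \<forall>g\<in>carrier (BS n). \<forall>j\<in>{1..n}.
      right_color (T g) = left_color (T (g \<otimes>\<^bsub>BS n\<^esub> bs_a n)) \<and>
      top_color (T g) =
        bottom (T (g \<otimes>\<^bsub>BS n\<^esub> bs_a n [^]\<^bsub>BS n\<^esub> (1 - int j) \<otimes>\<^bsub>BS n\<^esub> bs_b n)) j}"

text \<open>Only the letters 0 and 1 are relevant as arguments \<open>c\<close> of the substitution.\<close>

definition sigma_subst :: "nat \<Rightarrow> nat \<Rightarrow> nat \<Rightarrow> nat list" where
  "sigma_subst n r c =
    (if c = 0 then replicate (n - r - 1) 0 @ [1] @ replicate r 0 else replicate n 0)"

definition tau_sigma :: "nat \<Rightarrow> wang_tile set" where
  "tau_sigma n =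
    {\<lparr>top_color = c, left_color = i, right_color = i, bottom_colors = sigma_subst n i c\<rparr>
      | c i. c \<in> {0, 1} \<and> i \<in> {0..<n}}"

lemma tau_sigma_wang_tiles: "tau_sigma n \<subseteq> wang_tiles n"
  by (auto simp: tau_sigma_def wang_tiles_def sigma_subst_def)

end

theory Submission
  imports Defs Complex_Main "HOL-Computational_Algebra.Primes"
begin

text \<open>
  The substitution \<open>\<sigma>\<^sub>r\<close> writes zeros everywhere except at position \<open>n - 1 - r\<close>, where it writes the
  complement of its argument. Hence, in a valid tiling, the top word of the row \<open>g\<langle>a\<rangle>\<close> vanishes
  outside one residue class modulo \<open>n\<close>, and on that class it is the complement of the top word of
  the row \<open>gb\<langle>a\<rangle>\<close>. A period \<open>k > 0\<close> of the former is therefore a multiple of \<open>n\<close> and yields the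
  period \<open>k / n\<close> of the latter, so by descent no row is periodic. A finite orbit would
  however make the row of the identity periodic.

  For a weakly periodic tiling, let \<open>BS(1,n)\<close> act on the line by \<open>a(x) = x + 1\<close>, \<open>b(x) = n x\<close>, so
  that \<open>g(x) = n\<^sup>h x + q\<close>. The integer \<open>\<kappa>(g) = \<lfloor>- q / n\<^sup>h\<rfloor>\<close> satisfies \<open>\<kappa>(ga) = \<kappa>(g) - 1\<close>,
  \<open>\<kappa>(gb) = \<lfloor>\<kappa>(g) / n\<rfloor>\<close> and \<open>\<kappa>(bg) = \<kappa>(g)\<close>. The parity of the exponent of \<open>n\<close> in \<open>\<kappa>(g)\<close>
  (of \<open>h\<close> if \<open>\<kappa>(g) = 0\<close>) is the top color at \<open>g\<close> of a valid tiling fixed by \<open>b\<^sup>2\<close>.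
\<close>

section \<open>Subshifts given by constraints on pairs\<close>

text \<open>Forbid the finitely many patterns on the support \<open>{\<one>, d}\<close> that violate
  \<open>R\<close>; appearance is tested at every translate, so this enforces the constraint at
  every group element.\<close>

lemma SFT_pair_constraints:
  fixes G (structure) and A :: "'c set"
  assumes "group G" "finite A" "finite N" and d: "\<And>d R. (d, R) \<in> N \<Longrightarrow> d \<in> carrier G"
  shows "SFT G A {x \<in> configurations G A. \<forall>g\<in>carrier G. \<forall>(d, R)\<in>N. R (x g) (x (g \<otimes> d))}"
    (is "SFT G A ?X")
proof -
  interpret group G by fact
  define F where
    "F = (\<Union>(d, R)\<in>N. (\<lambda>p. ({\<one>, d}, p)) ` {p \<in> {\<one>, d} \<rightarrow>\<^sub>E A. \<not> R (p \<one>) (p d)})"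
  have "finite F"
  proof -
    have "finite {p \<in> {\<one>, d} \<rightarrow>\<^sub>E A. \<not> R (p \<one>) (p d)}" for d and R :: "'c \<Rightarrow> 'c \<Rightarrow> bool"
      using assms(2) by (intro finite_subset[OF _ finite_PiE[of "{\<one>, d}" "\<lambda>_. A"]]) blast+
    then show ?thesis unfolding F_def using assms(3) by (auto intro!: finite_UN_I)
  qed
  moreover have "F \<subseteq> patterns G A"
    unfolding F_def patterns_def using d by auto
  moreover have "?X = {x \<in> configurations G A. \<forall>q\<in>F. \<not> appears_in G q x}"
  proof (intro Collect_cong conj_cong refl iffI ballI)
    fix x q
    assume x: "\<forall>g\<in>carrier G. \<forall>(d, R)\<in>N. R (x g) (x (g \<otimes> d))" and "q \<in> F"
    then obtain d' R p where q: "(d', R) \<in> N" "q = ({\<one>, d'}, p)" "\<not> R (p \<one>) (p d')"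
      by (auto simp: F_def)
    show "\<not> appears_in G q x"
    proof
      assume "appears_in G q x"
      then obtain g where g: "g \<in> carrier G" "\<forall>h\<in>{\<one>, d'}. shift G g x h = p h"
        by (auto simp: appears_in_def q)
      then have p: "p \<one> = x (inv g)" "p d' = x (inv g \<otimes> d')"
        using d[OF q(1)] by (auto simp: shift_def)
      have "R (x (inv g)) (x (inv g \<otimes> d'))"
        using bspec[OF bspec[OF x inv_closed[OF g(1)]] q(1)] by simp
      with q(3) show False unfolding p ..
    qed
  next
    fix x g dR
    assume x: "x \<in> configurations G A" and F: "\<forall>q\<in>F. \<not> appears_in G q x"
      and g: "g \<in> carrier G" and "dR \<in> N"
    then obtain d' R where dR: "dR = (d', R)" and N: "(d', R) \<in> N" by (cases dR) auto
    show "case dR of (d, R) \<Rightarrow> R (x g) (x (g \<otimes> d))"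
      unfolding dR prod.case
    proof (rule ccontr)
      assume R: "\<not> R (x g) (x (g \<otimes> d'))"
      have d': "d' \<in> carrier G" using d N .
      let ?p = "restrict (\<lambda>h. x (g \<otimes> h)) {\<one>, d'}"
      have "?p \<in> {\<one>, d'} \<rightarrow>\<^sub>E A"
        using x g d' by (auto simp: configurations_def)
      moreover have "\<not> R (?p \<one>) (?p d')" using R g by simp
      ultimately have "({\<one>, d'}, ?p) \<in> F"
        unfolding F_def using N by (intro UN_I[OF N]) auto
      \<comment> \<open>The action reads \<open>x\<close> at the inverse of the translating element,
        so \<open>inv g\<close> brings position \<open>g\<close> to the identity.\<close>
      moreover have "appears_in G ({\<one>, d'}, ?p) x"
        unfolding appears_in_def using g d' by (intro bexI[of _ "inv g"]) (auto simp: shift_def)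
      ultimately show False using F by blast
    qed
  qed
  ultimately show ?thesis unfolding SFT_def using assms(2) by blast
qed

section \<open>Valid tilings as a subshift of finite type\<close>

lemma finite_tau_sigma: "finite (tau_sigma n)"
proof -
  have "tau_sigma n = (\<lambda>(c, i). \<lparr>top_color = c, left_color = i, right_color = i,
      bottom_colors = sigma_subst n i c\<rparr>) ` ({0, 1} \<times> {0..<n})"
    by (auto simp: tau_sigma_def image_iff)
  then show ?thesis by simp
qed

interpretation BS: group "BS n" for n
  by (rule group_BS)

lemmas [simp] = bs_a_carrier bs_b_carrier

lemma SFT_valid_tilings:
  assumes "n \<ge> 1" "finite \<tau>"
  shows "SFT (BS n) \<tau> (valid_tilings n \<tau>)"
proof -
  define N :: "(_ \<times> (wang_tile \<Rightarrow> wang_tile \<Rightarrow> bool)) set" where "N = insert (bs_a n, \<lambda>s t. right_color s = left_color t)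
    ((\<lambda>j. (bs_a n [^]\<^bsub>BS n\<^esub> (1 - int j) \<otimes>\<^bsub>BS n\<^esub> bs_b n, \<lambda>s t. top_color s = bottom t j))
      ` {1..n})"
  have "valid_tilings n \<tau> = {x \<in> configurations (BS n) \<tau>. \<forall>g\<in>carrier (BS n).
      \<forall>(d, R)\<in>N. R (x g) (x (g \<otimes>\<^bsub>BS n\<^esub> d))}"
    \<comment> \<open>The horizontal rule stands under the quantifier over \<open>j\<close>, so it
      takes a nonempty range \<open>{1..n}\<close> to make it effective.\<close>
    unfolding valid_tilings_def N_def using assms(1)
    by (intro Collect_cong conj_cong refl ball_cong) (fastforce simp: BS.m_assoc)
  moreover have "SFT (BS n) \<tau> \<dots>"
    by (rule SFT_pair_constraints) (auto simp: N_def assms group_BS)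
  ultimately show ?thesis by simp
qed

section \<open>Rows of valid tilings\<close>

text \<open>The defining relation says \<open>b a = a^n b\<close>; iterating it carries
  \<open>b\<close> across powers of \<open>a\<close> and so links the row of \<open>g\<close> to the
  row of \<open>gb\<close>.\<close>

lemma bs_b_a_pow:
  "bs_b n \<otimes>\<^bsub>BS n\<^esub> bs_a n [^]\<^bsub>BS n\<^esub> m = bs_a n [^]\<^bsub>BS n\<^esub> (int n * m) \<otimes>\<^bsub>BS n\<^esub> bs_b n"
proof -
  let ?c = "bs_a n [^]\<^bsub>BS n\<^esub> int n"
  have ba: "bs_b n \<otimes>\<^bsub>BS n\<^esub> bs_a n = ?c \<otimes>\<^bsub>BS n\<^esub> bs_b n"
  proof -
    have "bs_b n \<otimes>\<^bsub>BS n\<^esub> bs_a n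
        = bs_b n \<otimes>\<^bsub>BS n\<^esub> bs_a n \<otimes>\<^bsub>BS n\<^esub> inv\<^bsub>BS n\<^esub> bs_b n \<otimes>\<^bsub>BS n\<^esub> bs_b n"
      by (simp add: BS.m_assoc)
    then show ?thesis
      unfolding BS_relation by (simp add: int_pow_int)
  qed
  \<comment> \<open>Negative exponents in the induction need the same exchange rule for the inverse
    of \<open>a\<close>.\<close>
  have ba': "bs_b n \<otimes>\<^bsub>BS n\<^esub> inv\<^bsub>BS n\<^esub> bs_a n = inv\<^bsub>BS n\<^esub> ?c \<otimes>\<^bsub>BS n\<^esub> bs_b n"
  proof -
    have "?c \<otimes>\<^bsub>BS n\<^esub> (bs_b n \<otimes>\<^bsub>BS n\<^esub> inv\<^bsub>BS n\<^esub> bs_a n)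
        = bs_b n \<otimes>\<^bsub>BS n\<^esub> bs_a n \<otimes>\<^bsub>BS n\<^esub> inv\<^bsub>BS n\<^esub> bs_a n"
      unfolding ba by (simp add: BS.m_assoc)
    also have "\<dots> = bs_b n"
      by (simp add: BS.m_assoc)
    finally show ?thesis
      by (simp add: BS.inv_solve_left)
  qed
  have "bs_b n \<otimes>\<^bsub>BS n\<^esub> bs_a n [^]\<^bsub>BS n\<^esub> m = ?c [^]\<^bsub>BS n\<^esub> m \<otimes>\<^bsub>BS n\<^esub> bs_b n"
  proof (induction m rule: int_induct[where k = 0])
    case base
    show ?case by simp
  next
    case (step1 i)
    have "bs_b n \<otimes>\<^bsub>BS n\<^esub> bs_a n [^]\<^bsub>BS n\<^esub> (i + 1)
        = bs_b n \<otimes>\<^bsub>BS n\<^esub> bs_a n [^]\<^bsub>BS n\<^esub> i \<otimes>\<^bsub>BS n\<^esub> bs_a n"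
      by (simp add: BS.int_pow_mult BS.m_assoc)
    also have "\<dots> = ?c [^]\<^bsub>BS n\<^esub> i \<otimes>\<^bsub>BS n\<^esub> (bs_b n \<otimes>\<^bsub>BS n\<^esub> bs_a n)"
      unfolding step1(2) by (simp add: BS.m_assoc)
    also have "\<dots> = ?c [^]\<^bsub>BS n\<^esub> (i + 1) \<otimes>\<^bsub>BS n\<^esub> bs_b n"
      unfolding ba by (simp add: BS.int_pow_mult BS.m_assoc)
    finally show ?case .
  next
    case (step2 i)
    have "bs_b n \<otimes>\<^bsub>BS n\<^esub> bs_a n [^]\<^bsub>BS n\<^esub> (i - 1)
        = bs_b n \<otimes>\<^bsub>BS n\<^esub> bs_a n [^]\<^bsub>BS n\<^esub> i \<otimes>\<^bsub>BS n\<^esub> inv\<^bsub>BS n\<^esub> bs_a n"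
      by (simp add: BS.int_pow_diff BS.m_assoc)
    also have "\<dots> = ?c [^]\<^bsub>BS n\<^esub> i \<otimes>\<^bsub>BS n\<^esub> (bs_b n \<otimes>\<^bsub>BS n\<^esub> inv\<^bsub>BS n\<^esub> bs_a n)"
      unfolding step2(2) by (simp add: BS.m_assoc)
    also have "\<dots> = ?c [^]\<^bsub>BS n\<^esub> (i - 1) \<otimes>\<^bsub>BS n\<^esub> bs_b n"
      unfolding ba' by (simp add: BS.int_pow_diff BS.m_assoc)
    finally show ?case .
  qed
  then show ?thesis by (simp add: BS.int_pow_pow)
qed

lemma sigma_subst_nth:
  assumes "r < n" "t < n" "c \<in> {0, 1}"
  shows "sigma_subst n r c ! t = (if t = n - 1 - r then 1 - c else 0)"
  using assms by (auto simp: sigma_subst_def nth_append nth_Cons')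

definition row :: "nat \<Rightarrow> (bs_generator word set \<Rightarrow> wang_tile) \<Rightarrow> bs_generator word set \<Rightarrow> int \<Rightarrow> nat"
  where "row n T g p = top_color (T (g \<otimes>\<^bsub>BS n\<^esub> bs_a n [^]\<^bsub>BS n\<^esub> p))"

context
  fixes n :: nat and T
  assumes n: "n \<ge> 2" and T: "T \<in> valid_tilings n (tau_sigma n)"
begin

lemma valid_tiling_cases:
  assumes "g \<in> carrier (BS n)"
  obtains c i where "c \<in> {0, 1}" "i < n"
    "T g = \<lparr>top_color = c, left_color = i, right_color = i, bottom_colors = sigma_subst n i c\<rparr>"
proof -
  have "T g \<in> tau_sigma n"
    using T assms by (auto simp: valid_tilings_def configurations_def)
  then show ?thesis using that by (auto simp: tau_sigma_def)
qed

lemma valid_tiling_top: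
  assumes "g \<in> carrier (BS n)" "1 \<le> j" "j \<le> n"
  shows "top_color (T g)
    = bottom (T (g \<otimes>\<^bsub>BS n\<^esub> bs_a n [^]\<^bsub>BS n\<^esub> (1 - int j) \<otimes>\<^bsub>BS n\<^esub> bs_b n)) j"
proof -
  have "j \<in> {1..n}" using assms(2,3) by simp
  with T assms(1) show ?thesis unfolding valid_tilings_def by blast
qed

text \<open>Tiles in \<open>tau_sigma\<close> have equal left and right colors, so horizontal
  matching carries a single color, hence a single substitution, along a whole row.\<close>

lemma left_color_row:
  assumes g: "g \<in> carrier (BS n)"
  shows "left_color (T (g \<otimes>\<^bsub>BS n\<^esub> bs_a n [^]\<^bsub>BS n\<^esub> (p :: int))) = left_color (T g)"
proof -
  have step: "left_color (T (h \<otimes>\<^bsub>BS n\<^esub> bs_a n)) = left_color (T h)" if "h \<in> carrier (BS n)" for h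
  proof -
    have "right_color (T h) = left_color (T (h \<otimes>\<^bsub>BS n\<^esub> bs_a n))"
      using T that n by (force simp: valid_tilings_def)
    moreover have "left_color (T h) = right_color (T h)"
      by (rule valid_tiling_cases[OF that]) simp
    ultimately show ?thesis by simp
  qed
  have shift: "g \<otimes>\<^bsub>BS n\<^esub> bs_a n [^]\<^bsub>BS n\<^esub> (i + 1) = g \<otimes>\<^bsub>BS n\<^esub> bs_a n [^]\<^bsub>BS n\<^esub> i \<otimes>\<^bsub>BS n\<^esub> bs_a n"
    for i :: int
    using g by (simp add: BS.int_pow_mult BS.m_assoc)
  show ?thesis
  proof (induction p rule: int_induct[where k = 0])
    case base
    show ?case using g by simp
  next
    case (step1 i)
    then show ?case using g by (simp add: shift step)
  next
    case (step2 i)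
    then show ?case using g shift[of "i - 1"] by (simp add: step)
  qed
qed

text \<open>With p = n m + t, the vertical rule for j = t + 1 leads from \<open>g a^p\<close> to
  \<open>g a^(n m) b = g b a^m\<close>: letter p of the row is letter t of the substitution word at
  cell m of the row of \<open>gb\<close>. The common side color i of that row fixes the residue n -
  1 - i.\<close>

lemma row_desubstitution:
  assumes g: "g \<in> carrier (BS n)"
  obtains r where "0 \<le> r" "r < int n"
    "\<And>p. row n T g p = (if p mod int n = r then 1 - row n T (g \<otimes>\<^bsub>BS n\<^esub> bs_b n) (p div int n) else 0)"
proof -
  let ?gb = "g \<otimes>\<^bsub>BS n\<^esub> bs_b n"
  define i where "i = left_color (T ?gb)"
  have i: "i < n"
    unfolding i_def by (rule valid_tiling_cases[of ?gb]) (use g in auto)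
  have "row n T g p = (if p mod int n = int (n - 1 - i) then 1 - row n T ?gb (p div int n) else 0)"
    for p
  proof -
    define m t where "m = p div int n" and "t = nat (p mod int n)"
    have t: "t < n" "int t = p mod int n" using n by (auto simp: t_def nat_less_iff)
    have p: "p = int n * m + int t" by (simp add: t m_def)
    let ?h = "g \<otimes>\<^bsub>BS n\<^esub> bs_a n [^]\<^bsub>BS n\<^esub> p"
    have "?h \<otimes>\<^bsub>BS n\<^esub> bs_a n [^]\<^bsub>BS n\<^esub> (1 - int (t + 1)) \<otimes>\<^bsub>BS n\<^esub> bs_b n
        = g \<otimes>\<^bsub>BS n\<^esub> (bs_a n [^]\<^bsub>BS n\<^esub> (p + (1 - int (t + 1))) \<otimes>\<^bsub>BS n\<^esub> bs_b n)"
      unfolding BS.int_pow_mult[OF bs_a_carrier] using g by (simp add: BS.m_assoc)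
    also have "\<dots> = ?gb \<otimes>\<^bsub>BS n\<^esub> bs_a n [^]\<^bsub>BS n\<^esub> m" (is "_ = ?u")
      using g by (simp add: p bs_b_a_pow BS.m_assoc)
    finally have "top_color (T ?h) = bottom (T ?u) (t + 1)"
      using valid_tiling_top[of ?h "t + 1"] g t(1) by simp
    moreover have u: "?u \<in> carrier (BS n)" using g by simp
    moreover have "left_color (T ?u) = i"
      unfolding i_def using g by (intro left_color_row) simp
    moreover obtain c i' where "c \<in> {0, 1}" "T ?u = \<lparr>top_color = c, left_color = i', right_color = i',
        bottom_colors = sigma_subst n i' c\<rparr>"
      by (rule valid_tiling_cases[OF u])
    ultimately have "row n T g p = (if t = n - 1 - i then 1 - row n T ?gb m else 0)"
      using t(1) i by (simp add: row_def bottom_def sigma_subst_nth)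
    then show ?thesis using t(2)[symmetric] by (simp add: m_def)
  qed
  then show thesis using i n by (intro that[of "int (n - 1 - i)"]) auto
qed

text \<open>The row of \<open>gb\<close> is itself supported on one residue class, so it has a zero
  because n \<ge> 2; the complement of that zero is a one in the row of \<open>g\<close>.\<close>

lemma row_nonzero:
  assumes g: "g \<in> carrier (BS n)"
  obtains p where "row n T g p = 1"
proof -
  obtain r where r: "0 \<le> r" "r < int n"
    "\<And>p. row n T g p = (if p mod int n = r then 1 - row n T (g \<otimes>\<^bsub>BS n\<^esub> bs_b n) (p div int n) else 0)"
    using row_desubstitution[OF g] by blast
  obtain r' where r': "\<And>p. p mod int n \<noteq> r' \<Longrightarrow> row n T (g \<otimes>\<^bsub>BS n\<^esub> bs_b n) p = 0"
    using row_desubstitution[of "g \<otimes>\<^bsub>BS n\<^esub> bs_b n"] g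
    by (metis BS.m_closed bs_b_carrier)
  \<comment> \<open>0 and 1 are incongruent modulo n, so one of them avoids the class
    \<open>r'\<close>.\<close>
  define t :: int where "t = (if r' = 0 then 1 else 0)"
  have "row n T (g \<otimes>\<^bsub>BS n\<^esub> bs_b n) t = 0"
    using n by (intro r') (auto simp: t_def)
  then have "row n T g (int n * t + r) = 1"
    using r n by simp
  then show thesis using that by blast
qed

lemma row_not_periodic:
  assumes "g \<in> carrier (BS n)" "k > 0"
  shows "\<exists>p. row n T g (p + int k) \<noteq> row n T g p"
  using assms
\<comment> \<open>The induction varies \<open>g\<close>, since the smaller period belongs to the row
  of \<open>gb\<close>.\<close>
proof (induction k arbitrary: g rule: less_induct)
  case (less k)
  show ?case
  proof (rule ccontr)
    assume "\<not> ?thesis"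
    then have per: "row n T g (p + int k) = row n T g p" for p by blast
    obtain r where r: "0 \<le> r" "r < int n"
      "\<And>p. row n T g p = (if p mod int n = r then 1 - row n T (g \<otimes>\<^bsub>BS n\<^esub> bs_b n) (p div int n) else 0)"
      using row_desubstitution[OF less.prems(1)] by blast
    obtain p where p: "row n T g p = 1"
      using row_nonzero[OF less.prems(1)] .
    \<comment> \<open>Ones occur only in the class \<open>r\<close>, and both p and p + k carry
      one.\<close>
    have "p mod int n = r" "(p + int k) mod int n = r"
      using p per[of p] r(3)[of p] r(3)[of "p + int k"] by (auto split: if_splits)
    then have "int n dvd int k"
      by (metis add_diff_cancel_left' mod_eq_dvd_iff)
    then obtain k' where k': "k = n * k'" by auto
    \<comment> \<open>On naturals, \<open>1 - x\<close> determines x only for x \<le> 1; this bound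
      lets the complement be cancelled below.\<close>
    have le: "row n T h q \<le> 1" if "h \<in> carrier (BS n)" for h q
      unfolding row_def
      by (rule valid_tiling_cases[of "h \<otimes>\<^bsub>BS n\<^esub> bs_a n [^]\<^bsub>BS n\<^esub> q"]) (use that in auto)
    have "row n T (g \<otimes>\<^bsub>BS n\<^esub> bs_b n) (m + int k') = row n T (g \<otimes>\<^bsub>BS n\<^esub> bs_b n) m" for m
    proof -
      have eq: "row n T g (int n * m' + r) = 1 - row n T (g \<otimes>\<^bsub>BS n\<^esub> bs_b n) m'" for m'
        using r n by simp
      have "row n T g (int n * (m + int k') + r) = row n T g (int n * m + r)"
        using per[of "int n * m + r"] by (simp add: k' algebra_simps)
      then have "1 - row n T (g \<otimes>\<^bsub>BS n\<^esub> bs_b n) (m + int k') = 1 - row n T (g \<otimes>\<^bsub>BS n\<^esub> bs_b n) m"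
        by (simp only: eq)
      then show ?thesis
        using le[of "g \<otimes>\<^bsub>BS n\<^esub> bs_b n" "m + int k'"] le[of "g \<otimes>\<^bsub>BS n\<^esub> bs_b n" m] less.prems(1)
        by simp
    qed
    moreover have "k' < k" "k' > 0"
      using less.prems(2) n by (auto simp: k')
    ultimately show False
      using less.IH[of k' "g \<otimes>\<^bsub>BS n\<^esub> bs_b n"] less.prems(1) by auto
  qed
qed

text \<open>Pigeonhole on the translates by powers of \<open>a\<close>: two equal ones give the row
  of the identity a positive period.\<close>

lemma valid_tiling_not_strongly_periodic: "\<not> strongly_periodic (BS n) T"
proof
  assume fin: "strongly_periodic (BS n) T"
  define f where "f = (\<lambda>i :: nat. shift (BS n) (bs_a n [^]\<^bsub>BS n\<^esub> int i) T)"
  have "range f \<subseteq> orbit (BS n) (shift (BS n)) T"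
    by (auto simp: orbit_def f_def)
  with fin have "finite (range f)"
    unfolding strongly_periodic_def by (rule finite_subset[rotated])
  then have "\<not> inj f"
    using finite_imageD infinite_UNIV_nat by blast
  then obtain i j where ij: "i < j" "f i = f j"
    using linorder_injI[of f] by blast
  have "row n T \<one>\<^bsub>BS n\<^esub> (p + int (j - i)) = row n T \<one>\<^bsub>BS n\<^esub> p" for p
  proof -
    \<comment> \<open>At \<open>a^(j + p)\<close> the translate by \<open>a^k\<close> shows letter j
      + p - k of the row; k = i and k = j give the letters p + (j - i) and p.\<close>
    have eq: "row n T \<one>\<^bsub>BS n\<^esub> (int j + p - int k)
        = top_color (f k (bs_a n [^]\<^bsub>BS n\<^esub> (int j + p)))" for k
    proof -
      have "inv\<^bsub>BS n\<^esub> (bs_a n [^]\<^bsub>BS n\<^esub> int k) \<otimes>\<^bsub>BS n\<^esub> bs_a n [^]\<^bsub>BS n\<^esub> (int j + p)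
          = bs_a n [^]\<^bsub>BS n\<^esub> (- int k + (int j + p))"
        by (simp only: BS.int_pow_neg BS.int_pow_mult bs_a_carrier)
      also have "- int k + (int j + p) = int j + p - int k" by simp
      finally show ?thesis by (simp add: f_def shift_def row_def)
    qed
    have "row n T \<one>\<^bsub>BS n\<^esub> (int j + p - int i) = row n T \<one>\<^bsub>BS n\<^esub> (int j + p - int j)"
      unfolding eq ij(2) ..
    moreover have shifts: "int j + p - int i = p + int (j - i)" "int j + p - int j = p"
      using ij(1) by auto
    ultimately show ?thesis unfolding shifts by blast
  qed
  moreover have "\<exists>p. row n T \<one>\<^bsub>BS n\<^esub> (p + int (j - i)) \<noteq> row n T \<one>\<^bsub>BS n\<^esub> p"
    by (rule row_not_periodic) (use ij(1) in simp_all)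
  ultimately show False by blast
qed

end

section \<open>The affine action\<close>

text \<open>The exponent h in the affine map x -> n^h x + q of a word.\<close>

fun word_height :: "bs_generator word \<Rightarrow> int" where
  "word_height [] = 0"
| "word_height ((GenA, s) # w) = word_height w"
| "word_height ((GenB, s) # w) = (if s then 1 else - 1) + word_height w"

text \<open>The offset q, that is, the image of 0; the first letter of a word is applied last, as in
  a composition of maps.\<close>

fun word_translation :: "nat \<Rightarrow> bs_generator word \<Rightarrow> real" where
  "word_translation n [] = 0"
| "word_translation n ((GenA, s) # w) = (if s then 1 else - 1) + word_translation n w"
| "word_translation n ((GenB, s) # w) = (if s then real n else 1 / real n) * word_translation n w"

lemma word_height_append: "word_height (u @ v) = word_height u + word_height v"
  by (induction u rule: word_height.induct) auto

lemma word_translation_append: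
  assumes "n > 0"
  shows "word_translation n (u @ v)
    = word_translation n u + real n powi word_height u * word_translation n v"
  using assms
  by (induction u rule: word_height.induct)
    (auto simp: algebra_simps power_int_add power_int_minus divide_simps)

lemma word_translation_replicate_GenA: "word_translation n (replicate k (GenA, True)) = real k"
  by (induction k) auto

lemma word_height_replicate_GenA: "word_height (replicate k (GenA, s)) = 0"
  by (induction k) auto

text \<open>Both sides of the relation act as x -> x + n, and inverse letters act as inverse maps
  since n > 0. So height and offset descend to the group.\<close>

lemma pres_eq_word_invariants:
  assumes "pres_eq (BS_relations n) u v" "n > 0"
  shows "word_height u = word_height v \<and> word_translation n u = word_translation n v"
  using assms
proof (induction rule: pres_eq.induct)
  case (pres_cancel x s)
  then show ?case by (cases x; cases s) auto
next
  case (pres_relation u v)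
  then show ?case
    by (auto simp: BS_relations_def word_translation_replicate_GenA word_height_replicate_GenA)
qed (auto simp: word_height_append word_translation_append)

definition height :: "bs_generator word set \<Rightarrow> int" where
  "height g = word_height (SOME u. u \<in> g)"

definition translation :: "nat \<Rightarrow> bs_generator word set \<Rightarrow> real" where
  "translation n g = word_translation n (SOME u. u \<in> g)"

context
  fixes n :: nat
  assumes n: "n \<ge> 2"
begin

lemma
  shows height_class: "height (pres_rel (BS_relations n) `` {u}) = word_height u"
    and translation_class: "translation n (pres_rel (BS_relations n) `` {u}) = word_translation n u"
proof -
  let ?v = "SOME v. v \<in> pres_rel (BS_relations n) `` {u}"
  have "?v \<in> pres_rel (BS_relations n) `` {u}"
    by (rule someI[of _ u]) (simp add: pres_rel_def pres_refl)
  then have "pres_eq (BS_relations n) u ?v" by (simp add: pres_rel_def)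
  from pres_eq_word_invariants[OF this] n
  show "height (pres_rel (BS_relations n) `` {u}) = word_height u"
    and "translation n (pres_rel (BS_relations n) `` {u}) = word_translation n u"
    by (simp_all add: height_def translation_def)
qed

lemma BS_carrierE:
  assumes "g \<in> carrier (BS n)"
  obtains u where "g = pres_rel (BS_relations n) `` {u}"
  using assms by (auto simp: BS_def presented_group_def elim: quotientE)

lemma BS_one: "\<one>\<^bsub>BS n\<^esub> = pres_rel (BS_relations n) `` {[]}"
  by (simp add: BS_def presented_group_def)

lemma
  assumes "g \<in> carrier (BS n)" "h \<in> carrier (BS n)"
  shows height_mult: "height (g \<otimes>\<^bsub>BS n\<^esub> h) = height g + height h"
    and translation_mult: "translation n (g \<otimes>\<^bsub>BS n\<^esub> h)
      = translation n g + real n powi height g * translation n h"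
proof -
  obtain u v where uv: "g = pres_rel (BS_relations n) `` {u}" "h = pres_rel (BS_relations n) `` {v}"
    using assms by (metis BS_carrierE)
  then have gh: "g \<otimes>\<^bsub>BS n\<^esub> h = pres_rel (BS_relations n) `` {u @ v}"
    by (simp add: BS_def presented_group_mult)
  show "height (g \<otimes>\<^bsub>BS n\<^esub> h) = height g + height h"
    unfolding gh unfolding uv height_class by (rule word_height_append)
  show "translation n (g \<otimes>\<^bsub>BS n\<^esub> h) = translation n g + real n powi height g * translation n h"
    unfolding gh unfolding uv height_class translation_class using n by (intro word_translation_append) simp
qed

lemma height_simps [simp]:
  "height \<one>\<^bsub>BS n\<^esub> = 0" "height (bs_a n) = 0" "height (bs_b n) = 1"
  by (simp_all add: BS_one bs_a_def bs_b_def height_class)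

lemma translation_simps [simp]:
  "translation n \<one>\<^bsub>BS n\<^esub> = 0" "translation n (bs_a n) = 1" "translation n (bs_b n) = 0"
  by (simp_all add: BS_one bs_a_def bs_b_def translation_class)

lemma height_translation_a_pow:
  "height (bs_a n [^]\<^bsub>BS n\<^esub> (k :: int)) = 0 \<and> translation n (bs_a n [^]\<^bsub>BS n\<^esub> k) = of_int k"
proof -
  have step: "height (bs_a n [^]\<^bsub>BS n\<^esub> (i + 1)) = height (bs_a n [^]\<^bsub>BS n\<^esub> i)"
    "translation n (bs_a n [^]\<^bsub>BS n\<^esub> (i + 1))
      = translation n (bs_a n [^]\<^bsub>BS n\<^esub> i) + real n powi height (bs_a n [^]\<^bsub>BS n\<^esub> i)" for i :: int
    by (simp_all add: BS.int_pow_mult height_mult translation_mult)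
  show ?thesis
  proof (induction k rule: int_induct[where k = 0])
    case base
    show ?case by simp
  next
    case (step1 i)
    then show ?case by (simp add: step)
  next
    case (step2 i)
    then show ?case using step[of "i - 1"] by simp
  qed
qed

section \<open>A weakly periodic tiling\<close>

text \<open>The real under the floor is the preimage of 0 under the affine map of \<open>g\<close>.
  Hence right multiplication by \<open>a^k\<close> subtracts k from it, right multiplication by
  \<open>b\<close> divides it by n, and left multiplication by \<open>b\<close> preserves it, as
  \<open>b\<close> fixes 0.\<close>

definition kappa :: "bs_generator word set \<Rightarrow> int" where
  "kappa g = \<lfloor>- translation n g / real n powi height g\<rfloor>"

text \<open>Along \<open>g, gb, gbb, ...\<close> the value 0 of \<open>kappa\<close> persists and
  has no finite exponent of n; the height still grows by one each time, so its parity supplies the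
  required alternation.\<close>

definition periodic_top :: "bs_generator word set \<Rightarrow> nat" where
  "periodic_top g =
    (if kappa g = 0 then nat (height g mod 2) else multiplicity (int n) (kappa g) mod 2)"

text \<open>The argument of \<open>floor\<close> is the one in \<open>kappa\<close> for \<open>g b\<^sup>-\<^sup>1\<close>: the residue of \<open>\<kappa>(g b\<^sup>-\<^sup>1)\<close> is the
  nonzero class of the row that the tile at \<open>g\<close> has to produce.\<close>

definition periodic_side :: "bs_generator word set \<Rightarrow> nat" where
  "periodic_side g =
    nat (int n - 1 - \<lfloor>- translation n g / real n powi height g * real n\<rfloor> mod int n)"

definition periodic_tiling :: "bs_generator word set \<Rightarrow> wang_tile" where
  "periodic_tiling = (\<lambda>g\<in>carrier (BS n).
    \<lparr>top_color = periodic_top g, left_color = periodic_side g, right_color = periodic_side g,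
     bottom_colors = sigma_subst n (periodic_side g) (periodic_top g)\<rparr>)"

section \<open>Effect of right multiplication by \<open>a\<close> and \<open>b\<close> on
  \<open>kappa\<close> and the side color\<close>

lemma slope_a_pow:
  assumes "g \<in> carrier (BS n)"
  shows "- translation n (g \<otimes>\<^bsub>BS n\<^esub> bs_a n [^]\<^bsub>BS n\<^esub> k) /
      real n powi height (g \<otimes>\<^bsub>BS n\<^esub> bs_a n [^]\<^bsub>BS n\<^esub> k)
    = - translation n g / real n powi height g - of_int k"
  using assms n by (simp add: height_mult translation_mult height_translation_a_pow field_simps)

lemma kappa_a_pow:
  assumes "g \<in> carrier (BS n)"
  shows "kappa (g \<otimes>\<^bsub>BS n\<^esub> bs_a n [^]\<^bsub>BS n\<^esub> k) = kappa g - k"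
  unfolding kappa_def slope_a_pow[OF assms] by simp

lemma slope_b:
  assumes "g \<in> carrier (BS n)"
  shows "- translation n (g \<otimes>\<^bsub>BS n\<^esub> bs_b n) / real n powi height (g \<otimes>\<^bsub>BS n\<^esub> bs_b n)
    = - translation n g / real n powi height g / real n"
  using assms n by (simp add: height_mult translation_mult power_int_add)

text \<open>Taking the floor before dividing by a positive integer does not change the floor of the
  quotient.\<close>

lemma kappa_b:
  assumes "g \<in> carrier (BS n)"
  shows "kappa (g \<otimes>\<^bsub>BS n\<^esub> bs_b n) = kappa g div int n"
  unfolding kappa_def slope_b[OF assms] using n
  by (metis floor_divide_real_eq_div of_int_of_nat_eq of_nat_0_le_iff)

text \<open>The factor n turns the change of the slope by 1 into a change by n, which is invisible
  modulo n.\<close>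

lemma periodic_side_a:
  assumes "g \<in> carrier (BS n)"
  shows "periodic_side (g \<otimes>\<^bsub>BS n\<^esub> bs_a n) = periodic_side g"
proof -
  let ?y = "- translation n g / real n powi height g"
  have "\<lfloor>(?y - 1) * real n\<rfloor> = \<lfloor>?y * real n - of_int (int n)\<rfloor>"
    by (simp add: algebra_simps)
  also have "\<dots> = \<lfloor>?y * real n\<rfloor> - int n"
    by (rule floor_diff_of_int)
  finally show ?thesis
    using slope_a_pow[OF assms, of 1] by (simp add: periodic_side_def)
qed

lemma periodic_side_b:
  assumes "g \<in> carrier (BS n)"
  shows "periodic_side (g \<otimes>\<^bsub>BS n\<^esub> bs_b n) = nat (int n - 1 - kappa g mod int n)"
  unfolding periodic_side_def slope_b[OF assms] kappa_def using n by simp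

lemma periodic_side_less: "periodic_side g < n"
  unfolding periodic_side_def using n pos_mod_sign[of "int n"]
  by (simp add: nat_less_iff del: pos_mod_sign) (smt (verit))

lemma periodic_top_range: "periodic_top g \<in> {0, 1}"
  by (auto simp: periodic_top_def)

text \<open>Put t = j - 1 and k = \<open>kappa g\<close>. The side color at \<open>h\<close> selects
  position (k + t) mod n, which is t exactly when n divides k. In that case \<open>kappa h\<close>
  is k / n and the parity flips; otherwise the exponent of n in k is 0, matching the letter
  0.\<close>

lemma periodic_top_b:
  assumes g: "g \<in> carrier (BS n)" and "1 \<le> j" "j \<le> n"
  defines "h \<equiv> g \<otimes>\<^bsub>BS n\<^esub> bs_a n [^]\<^bsub>BS n\<^esub> (1 - int j) \<otimes>\<^bsub>BS n\<^esub> bs_b n"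
  shows "periodic_top g = sigma_subst n (periodic_side h) (periodic_top h) ! (j - 1)"
proof -
  define t where "t = j - 1"
  have t: "t < n" "1 - int j = - int t" using assms(2,3) by (auto simp: t_def)
  have kh: "kappa h = (kappa g + int t) div int n"
    and sh: "periodic_side h = nat (int n - 1 - (kappa g + int t) mod int n)"
    and hh: "height h = height g + 1"
    unfolding h_def t(2) using g
    by (simp_all add: kappa_b kappa_a_pow periodic_side_b height_mult height_translation_a_pow)
  have bound: "0 \<le> (kappa g + int t) mod int n" "(kappa g + int t) mod int n < int n"
    using n by auto
  have iff: "t = n - 1 - periodic_side h \<longleftrightarrow> int n dvd kappa g"
  proof -
    have "t = n - 1 - periodic_side h \<longleftrightarrow> int t = (kappa g + int t) mod int n"
      unfolding sh using bound t by linarith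
    also have "\<dots> \<longleftrightarrow> (kappa g + int t) mod int n = int t mod int n"
      using t by auto
    also have "\<dots> \<longleftrightarrow> int n dvd kappa g"
      by (simp add: mod_eq_dvd_iff)
    finally show ?thesis .
  qed
  have "periodic_top g = (if int n dvd kappa g then 1 - periodic_top h else 0)"
  proof (cases "int n dvd kappa g")
    case False
    then show ?thesis
      by (auto simp: periodic_top_def not_dvd_imp_multiplicity_0)
  next
    case True
    then obtain m where m: "kappa g = int n * m" ..
    have kh': "kappa h = m"
      using t n by (simp add: kh m)
    show ?thesis
    proof (cases "m = 0")
      case True
      \<comment> \<open>Here \<open>kappa\<close> is 0 at both places and the parity of the height
        flips instead.\<close>
      then show ?thesis using kh' m hh by (simp add: periodic_top_def mod2_eq_if)
    next
      case False
      \<comment> \<open>This holds for composite n as well, since n is a nonzero non-unit.\<close>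
      have "multiplicity (int n) (kappa g) = Suc (multiplicity (int n) m)"
        unfolding m using n False by (intro multiplicity_times_same) auto
      then show ?thesis
        using False m kh' n by (simp add: periodic_top_def) presburger
    qed
  qed
  then show ?thesis
    using iff sigma_subst_nth[OF periodic_side_less t(1) periodic_top_range, of h h]
    by (simp add: t_def)
qed

lemma periodic_tiling_valid: "periodic_tiling \<in> valid_tilings n (tau_sigma n)"
proof -
  have "periodic_tiling \<in> configurations (BS n) (tau_sigma n)"
    using periodic_side_less periodic_top_range
    by (auto simp: configurations_def periodic_tiling_def tau_sigma_def)
  then show ?thesis
    using periodic_top_b
    by (auto simp: valid_tilings_def periodic_tiling_def periodic_side_a bottom_def)
qed

text \<open>Since \<open>b\<close> fixes 0, the slope is unchanged; only the height changes, and the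
  square keeps its parity.\<close>

lemma periodic_tiling_b_squared:
  assumes "g \<in> carrier (BS n)"
  shows "periodic_tiling (bs_b n \<otimes>\<^bsub>BS n\<^esub> bs_b n \<otimes>\<^bsub>BS n\<^esub> g) = periodic_tiling g"
proof -
  let ?h = "bs_b n \<otimes>\<^bsub>BS n\<^esub> bs_b n \<otimes>\<^bsub>BS n\<^esub> g"
  have h: "height ?h = height g + 2"
    using assms by (simp add: height_mult)
  have "- translation n ?h / real n powi height ?h = - translation n g / real n powi height g"
    using assms n by (simp add: height_mult translation_mult power_int_add)
  then have "kappa ?h = kappa g" "periodic_side ?h = periodic_side g"
    unfolding kappa_def periodic_side_def by simp_all
  then show ?thesis
    using assms h by (simp add: periodic_tiling_def periodic_top_def)
qed

lemma periodic_tiling_weakly_periodic: "weakly_periodic (BS n) periodic_tiling"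
proof -
  let ?c = "bs_b n \<otimes>\<^bsub>BS n\<^esub> bs_b n"
  have "shift (BS n) ?c periodic_tiling h = periodic_tiling h" for h
  proof (cases "h \<in> carrier (BS n)")
    case True
    then have "?c \<otimes>\<^bsub>BS n\<^esub> (inv\<^bsub>BS n\<^esub> ?c \<otimes>\<^bsub>BS n\<^esub> h) = h"
      by (simp flip: BS.m_assoc)
    with True show ?thesis
      using periodic_tiling_b_squared[of "inv\<^bsub>BS n\<^esub> ?c \<otimes>\<^bsub>BS n\<^esub> h"] by (simp add: shift_def)
  \<comment> \<open>Outside the carrier both functions take the value
    \<open>undefined\<close>.\<close>
  qed (simp add: shift_def periodic_tiling_def)
  then have "?c \<in> stabilizer (BS n) (shift (BS n)) periodic_tiling"
    by (auto simp: stabilizer_def)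
  \<comment> \<open>The height separates \<open>b^2\<close>, of height 2, from the identity.\<close>
  moreover have "height ?c \<noteq> height \<one>\<^bsub>BS n\<^esub>"
    by (simp add: height_mult)
  ultimately show ?thesis
    unfolding weakly_periodic_def by (metis singletonD)
qed

end

theorem theorem3p7:
  fixes n :: nat
  assumes "n \<ge> 2"
  shows "SFT (BS n) (tau_sigma n) (valid_tilings n (tau_sigma n))
    \<and> weakly_aperiodic (BS n) (valid_tilings n (tau_sigma n))
    \<and> \<not> strongly_aperiodic (BS n) (valid_tilings n (tau_sigma n))"
  unfolding weakly_aperiodic_def strongly_aperiodic_def
  using SFT_valid_tilings[OF _ finite_tau_sigma, of n n]
    valid_tiling_not_strongly_periodic[OF assms]
    periodic_tiling_valid[OF assms] periodic_tiling_weakly_periodic[OF assms] assms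
  by auto

end
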